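(* Let $\mathcal{H}\in C^1(\mathbb{S}^2)$ and $v\in\mathbb{S}^2$ be such that $\mathcal{H}(v)\mathcal{H}(-v)<0$, and let $\Pi=v^\perp$. Let $M$ be a compact $\mathcal{H}$-surface whose boundary $\partial M$ is contained in the plane $\Pi$. (1) If $\mathcal{H}(v)>0$, then $\mathrm{int}(M)$ lies in the half-space $\{x\in\mathbb{R}^3:\langle x,v\rangle<0\}$. (2) If $\mathcal{H}(v)<0$, then $\mathrm{int}(M)$ lies in the half-space $\{x\in\mathbb{R}^3:\langle x,v\rangle>0\}$.
   Context: $\mathbb{S}^2$ is the unit sphere of $\mathbb{R}^3$, $\langle\cdot,\cdot\rangle$ the Euclidean metric, and $v^\perp=\{x\in\mathbb{R}^3:\langle x,v\rangle=0\}$. Surfaces are smooth, connected and oriented, immersed in $\mathbb{R}^3$ (not necessarily embedded), possibly with boundary, with Gauss map (unit normal field) $N:M\to\mathbb{S}^2$; $\mathrm{int}(M)=M\setminus\partial M$. The mean curvature $H_M$ is the average of the principal curvatures with respect to $N$, with the sign convention that the graph of $u$ oriented by $N=(-Du,1)/\sqrt{1+|Du|^2}$ has $2H_M=\mathrm{div}\big(Du/\sqrt{1+|Du|^2}\big)$ (so a unit sphere with inward normal has $H_M=1$). Given $\mathcal{H}\in C^1(\mathbb{S}^2)$, an $\mathcal{H}$-surface is a surface $M$ such that $H_M(p)=\mathcal{H}(N_p)$ for all $p\in M$. *)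

theory Defs
  imports "HOL-Analysis.Analysis" "HOL-Library.Extended_Nat"
begin

text \<open>Regularity. On an open set, a map is \<open>C\<^sup>k\<^sup>+\<^sup>1\<close> iff it is differentiable and all its directional
  derivatives are \<open>C\<^sup>k\<close>. On an arbitrary set (a piece of a closed half-plane, a sphere), being
  \<open>C\<^sup>k\<close> means having local \<open>C\<^sup>k\<close> extensions to open sets of the ambient space; for \<open>k = \<infinity>\<close> one
  extension has to be \<open>C\<^sup>i\<close> for all \<open>i\<close>.\<close>

primrec Ck_open :: "nat \<Rightarrow> 'a::euclidean_space set \<Rightarrow> ('a \<Rightarrow> 'b::real_normed_vector) \<Rightarrow> bool" where
  "Ck_open 0 W f \<longleftrightarrow> continuous_on W f"
| "Ck_open (Suc k) W f \<longleftrightarrow>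
     (\<forall>x\<in>W. f differentiable (at x)) \<and> (\<forall>h. Ck_open k W (\<lambda>x. frechet_derivative f (at x) h))"

definition C_diff :: "enat \<Rightarrow> 'a::euclidean_space set \<Rightarrow> ('a \<Rightarrow> 'b::real_normed_vector) \<Rightarrow> bool" where
  "C_diff k S f \<longleftrightarrow> (\<forall>x\<in>S. \<exists>W g. open W \<and> x \<in> W \<and>
      (\<forall>i. enat i \<le> k \<longrightarrow> Ck_open i W g) \<and> (\<forall>y\<in>W \<inter> S. g y = f y))"

abbreviation smooth_on :: "'a::euclidean_space set \<Rightarrow> ('a \<Rightarrow> 'b::real_normed_vector) \<Rightarrow> bool" where
  "smooth_on \<equiv> C_diff \<infinity>"

text \<open>Abstract smooth surfaces with (possibly empty) boundary. The underlying space is a topology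
  \<open>M\<close>; a chart \<open>(U, \<phi>)\<close> is a homeomorphism from an open set \<open>U\<close> onto a relatively open subset of
  the closed upper half-plane. The values of \<open>\<phi>\<close> outside \<open>U\<close> are irrelevant.\<close>

type_synonym 'a chart = "'a set \<times> ('a \<Rightarrow> real^2)"

definition half_plane :: "(real^2) set" where
  "half_plane = {z. 0 \<le> z $ 2}"

definition is_chart :: "'a topology \<Rightarrow> 'a chart \<Rightarrow> bool" where
  "is_chart M = (\<lambda>(U, \<phi>). openin M U \<and> openin (top_of_set half_plane) (\<phi> ` U) \<and>
      homeomorphic_map (subtopology M U) (top_of_set (\<phi> ` U)) \<phi>)"

definition in_chart :: "'a chart \<Rightarrow> ('a \<Rightarrow> 'b) \<Rightarrow> real^2 \<Rightarrow> 'b" where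
  "in_chart = (\<lambda>(U, \<phi>) F. F \<circ> the_inv_into U \<phi>)"

definition smooth_surface :: "'a topology \<Rightarrow> 'a chart set \<Rightarrow> bool" where
  "smooth_surface M \<A> \<longleftrightarrow> Hausdorff_space M \<and> second_countable M \<and>
     (\<forall>c\<in>\<A>. is_chart M c) \<and> (\<Union>(fst ` \<A>) = topspace M) \<and>
     (\<forall>c\<in>\<A>. \<forall>d\<in>\<A>. smooth_on (snd c ` (fst c \<inter> fst d)) (in_chart c (snd d)))"

definition surface_boundary :: "'a chart set \<Rightarrow> 'a set" where
  "surface_boundary \<A> = {p. \<exists>c\<in>\<A>. p \<in> fst c \<and> snd c p $ 2 = 0}"

definition surface_interior :: "'a topology \<Rightarrow> 'a chart set \<Rightarrow> 'a set" where
  "surface_interior M \<A> = topspace M - surface_boundary \<A>"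

definition smooth_function :: "'a chart set \<Rightarrow> ('a \<Rightarrow> 'b::real_normed_vector) \<Rightarrow> bool" where
  "smooth_function \<A> F \<longleftrightarrow> (\<forall>c\<in>\<A>. smooth_on (snd c ` fst c) (in_chart c F))"

text \<open>The differential of \<open>F\<close> at \<open>p\<close>, with the tangent space at \<open>p\<close> identified with the plane by
  the chart \<open>c\<close>. The derivative is taken within the image of the chart, where it is unique, so
  that boundary points are covered as well.\<close>

definition diff_at :: "'a chart \<Rightarrow> ('a \<Rightarrow> 'b::real_normed_vector) \<Rightarrow> 'a \<Rightarrow> real^2 \<Rightarrow> 'b" where
  "diff_at c F p = frechet_derivative (in_chart c F) (at (snd c p) within snd c ` fst c)"

definition immersion :: "'a chart set \<Rightarrow> ('a \<Rightarrow> real^3) \<Rightarrow> bool" where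
  "immersion \<A> X \<longleftrightarrow> smooth_function \<A> X \<and> (\<forall>c\<in>\<A>. \<forall>p\<in>fst c. inj (diff_at c X p))"

definition gauss_map :: "'a chart set \<Rightarrow> ('a \<Rightarrow> real^3) \<Rightarrow> ('a \<Rightarrow> real^3) \<Rightarrow> bool" where
  "gauss_map \<A> X N \<longleftrightarrow> smooth_function \<A> N \<and>
     (\<forall>c\<in>\<A>. \<forall>p\<in>fst c. N p \<in> sphere 0 1 \<and> (\<forall>w. N p \<bullet> diff_at c X p w = 0))"

text \<open>The orientation of an immersed surface is given by the choice of the unit normal \<open>N\<close>.\<close>

definition oriented_immersed_surface ::
    "'a topology \<Rightarrow> 'a chart set \<Rightarrow> ('a \<Rightarrow> real^3) \<Rightarrow> ('a \<Rightarrow> real^3) \<Rightarrow> bool" where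
  "oriented_immersed_surface M \<A> X N \<longleftrightarrow>
     smooth_surface M \<A> \<and> connected_space M \<and> immersion \<A> X \<and> gauss_map \<A> X N"

text \<open>\<open>\<kappa>\<^sub>1, \<kappa>\<^sub>2\<close> are the principal curvatures at \<open>p\<close>, with multiplicity: the shape operator, which
  sends \<open>dX(w)\<close> to \<open>-dN(w)\<close>, has an orthonormal basis \<open>dX(w\<^sub>1), dX(w\<^sub>2)\<close> of eigenvectors with
  eigenvalues \<open>\<kappa>\<^sub>1, \<kappa>\<^sub>2\<close>. The sign makes the curvatures of the unit sphere with inward normal
  \<open>N = -X\<close> equal to \<open>1\<close>. The shape operator does not depend on the chart.\<close>

definition principal_curvatures ::
    "'a chart set \<Rightarrow> ('a \<Rightarrow> real^3) \<Rightarrow> ('a \<Rightarrow> real^3) \<Rightarrow> 'a \<Rightarrow> real \<Rightarrow> real \<Rightarrow> bool" where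
  "principal_curvatures \<A> X N p \<kappa>\<^sub>1 \<kappa>\<^sub>2 \<longleftrightarrow> (\<exists>c\<in>\<A>. p \<in> fst c \<and> (\<exists>w\<^sub>1 w\<^sub>2.
      norm (diff_at c X p w\<^sub>1) = 1 \<and> norm (diff_at c X p w\<^sub>2) = 1 \<and>
      diff_at c X p w\<^sub>1 \<bullet> diff_at c X p w\<^sub>2 = 0 \<and>
      - diff_at c N p w\<^sub>1 = \<kappa>\<^sub>1 *\<^sub>R diff_at c X p w\<^sub>1 \<and>
      - diff_at c N p w\<^sub>2 = \<kappa>\<^sub>2 *\<^sub>R diff_at c X p w\<^sub>2))"

definition mean_curvature ::
    "'a chart set \<Rightarrow> ('a \<Rightarrow> real^3) \<Rightarrow> ('a \<Rightarrow> real^3) \<Rightarrow> 'a \<Rightarrow> real" where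
  "mean_curvature \<A> X N p =
     (THE H. \<exists>\<kappa>\<^sub>1 \<kappa>\<^sub>2. principal_curvatures \<A> X N p \<kappa>\<^sub>1 \<kappa>\<^sub>2 \<and> H = (\<kappa>\<^sub>1 + \<kappa>\<^sub>2) / 2)"

definition H_surface :: "(real^3 \<Rightarrow> real) \<Rightarrow>
    'a topology \<Rightarrow> 'a chart set \<Rightarrow> ('a \<Rightarrow> real^3) \<Rightarrow> ('a \<Rightarrow> real^3) \<Rightarrow> bool" where
  "H_surface \<H> M \<A> X N \<longleftrightarrow> oriented_immersed_surface M \<A> X N \<and>
     (\<forall>p\<in>topspace M. mean_curvature \<A> X N p = \<H> (N p))"

end

theory Submission
  imports Defs
begin

text \<open>Let \<open>p\<close> be a point where the height \<open>\<langle>X, v\<rangle>\<close> is maximal on the compact surface, and suppose that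
  \<open>p\<close> is not on the boundary. There the surface has a horizontal tangent plane, so \<open>N p = v\<close> or
  \<open>N p = - v\<close>, and it lies below that plane, so its mean curvature is \<open>\<le> 0\<close> in the first case and
  \<open>\<ge> 0\<close> in the second (lemma \<open>interior_max_mean_curvature\<close>). If \<open>\<H> v > 0\<close>, then \<open>\<H> (- v) < 0\<close>
  and both cases contradict the prescription \<open>H = \<H> \<circ> N\<close>. So interior points are never highest
  points. The maximal height is therefore attained on the boundary, where it is \<open>0\<close>, and an
  interior point of height \<open>0\<close> would be a highest point as well. This is the first claim, and the
  second one is the first for \<open>- v\<close>.

  The analytic content is the relation between mean curvature and height. In a chart \<open>\<phi>\<close> around an
  interior point \<open>p\<close>, differentiating \<open>\<langle>N, dX(b)\<rangle> = 0\<close> gives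
  \<open>- \<langle>dN(a), dX(b)\<rangle> = D\<^sup>2(\<langle>N p, X \<circ> \<phi>\<inverse>\<rangle>)(a, b)\<close>, so the second fundamental form is the Hessian of
  the height in the direction \<open>N p\<close> (lemma \<open>second_fundamental_form\<close>). The symmetry of the Hessian makes the
  shape operator self-adjoint, hence principal curvatures exist; their sum is a trace, hence it
  depends neither on the eigenbasis nor on the chart. So the mean curvature, which is defined by
  a definite description, is half the trace of this Hessian (lemma \<open>mean_curvature_eq_hess_trace\<close>),
  and at a highest point the Hessian of \<open>\<langle>X, v\<rangle>\<close> is negative semidefinite.\<close>

section \<open>Smooth maps near interior points\<close>

lemma Ck_open_cong:
  assumes "open W" "\<And>x. x \<in> W \<Longrightarrow> f x = g x" "Ck_open k W f"
  shows "Ck_open k W g"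
  using assms(2,3)
proof (induction k arbitrary: f g)
  case 0
  then show ?case by (simp cong: continuous_on_cong)
next
  case (Suc k)
  have D: "(g has_derivative frechet_derivative f (at x)) (at x)" if "x \<in> W" for x
  proof (rule has_derivative_transform_within_open[OF _ assms(1) that])
    show "(f has_derivative frechet_derivative f (at x)) (at x)"
      using Suc.prems(2) that by (simp add: frechet_derivative_works)
  qed (use Suc.prems(1) in auto)
  then have E: "frechet_derivative g (at x) = frechet_derivative f (at x)" if "x \<in> W" for x
    using that frechet_derivative_at by metis
  show ?case
    unfolding Ck_open.simps
  proof (intro conjI ballI allI)
    show "g differentiable at x" if "x \<in> W" for x
      using D[OF that] differentiableI by blast
    show "Ck_open k W (\<lambda>x. frechet_derivative g (at x) h)" for h
      by (rule Suc.IH[of "\<lambda>x. frechet_derivative f (at x) h"]) (use Suc.prems E in auto)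
  qed
qed

lemma Ck_open_subset: "Ck_open k W f \<Longrightarrow> V \<subseteq> W \<Longrightarrow> Ck_open k V f"
  by (induction k arbitrary: f) (auto intro: continuous_on_subset)

lemma smooth_on_imp_continuous_on:
  assumes "smooth_on S f"
  shows "continuous_on S f"
  unfolding continuous_on_eq_continuous_within
proof
  fix x assume "x \<in> S"
  then obtain W g where W: "open W" "x \<in> W" "Ck_open 0 W g" "\<forall>y\<in>W \<inter> S. g y = f y"
    using assms unfolding C_diff_def by (metis enat_ord_code(3))
  then have "continuous (at x) g"
    by (simp add: continuous_on_eq_continuous_at)
  then have "continuous (at x within S) g"
    by (rule continuous_at_imp_continuous_at_within)
  moreover obtain e where "e > 0" "ball x e \<subseteq> W"
    using W open_contains_ball by blast
  ultimately show "continuous (at x within S) f"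
    using W \<open>x \<in> S\<close>
    by (intro continuous_transform_within[of x S g e f]) (auto simp: subset_eq dist_commute)
qed

text \<open>At an interior point the local extension agrees with \<open>f\<close> itself on a neighbourhood, so \<open>f\<close>
  inherits its derivatives.\<close>

lemma smooth_on_interiorE:
  assumes "smooth_on S f" "x \<in> interior S"
  obtains W where "open W" "x \<in> W" "W \<subseteq> S" "\<And>k. Ck_open k W f"
proof -
  have "x \<in> S" using assms(2) interior_subset by blast
  then obtain W g where W: "open W" "x \<in> W" "\<And>k. Ck_open k W g" "\<And>y. y \<in> W \<inter> S \<Longrightarrow> g y = f y"
    using assms(1) unfolding C_diff_def by (metis enat_ord_code(3))
  show ?thesis
  proof
    show "open (W \<inter> interior S)" "x \<in> W \<inter> interior S" "W \<inter> interior S \<subseteq> S"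
      using W assms(2) interior_subset by auto
    show "Ck_open k (W \<inter> interior S) f" for k
      by (rule Ck_open_cong[of _ g])
        (use W interior_subset[of S] in \<open>auto intro: Ck_open_subset\<close>)
  qed
qed

lemma smooth_on_differentiable:
  assumes "smooth_on S f" "x \<in> interior S"
  shows "f differentiable at x"
proof -
  obtain W where "x \<in> W" "Ck_open (Suc 0) W f"
    using smooth_on_interiorE[OF assms] by metis
  then show ?thesis by auto
qed

section \<open>The Hessian as a limit of second differences\<close>

definition hess :: "('a::euclidean_space \<Rightarrow> real) \<Rightarrow> 'a \<Rightarrow> 'a \<Rightarrow> 'a \<Rightarrow> real" where
  "hess h x a b = frechet_derivative (\<lambda>y. frechet_derivative h (at y) b) (at x) a"

text \<open>Twice differentiability at the single point \<open>x\<close>: enough for the mean value theorem near \<open>x\<close>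
  and for a linear approximation of the first derivatives at \<open>x\<close>.\<close>

definition twice_diff :: "('a::euclidean_space \<Rightarrow> real) \<Rightarrow> 'a \<Rightarrow> bool" where
  "twice_diff h x \<longleftrightarrow> (\<forall>\<^sub>F y in nhds x. h differentiable at y) \<and>
     (\<forall>b. (\<lambda>y. frechet_derivative h (at y) b) differentiable at x)"

text \<open>This one limit yields both the symmetry of the Hessian and its sign at a maximum. The second
  difference is the increment over \<open>[0, t]\<close> of \<open>\<phi> s = h (x + t a + s b) - h (x + s b)\<close>. By the
  mean value theorem it equals \<open>t * \<phi>' s\<close> for some \<open>s\<close> in between, and \<open>\<phi>' s\<close> is a
  difference of two values of \<open>G = (\<lambda>y. Dh(y) b)\<close>, which the derivative \<open>Q\<close> of \<open>G\<close> at \<open>x\<close>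
  approximates by \<open>t * Q a\<close> up to \<open>o(t)\<close>.\<close>

lemma tendsto_hess:
  fixes h :: "'a::euclidean_space \<Rightarrow> real"
  assumes "twice_diff h x"
  shows "((\<lambda>t. (h (x + t *\<^sub>R a + t *\<^sub>R b) - h (x + t *\<^sub>R a) - h (x + t *\<^sub>R b) + h x) / t\<^sup>2)
            \<longlongrightarrow> hess h x a b) (at_right 0)"
proof (rule tendstoI)
  fix e :: real assume "e > 0"
  define G where "G y = frechet_derivative h (at y) b" for y
  define Q where "Q = frechet_derivative G (at x)"
  have Q: "(G has_derivative Q) (at x)"
    using assms unfolding twice_diff_def G_def Q_def by (simp add: frechet_derivative_works)
  then have linQ: "linear Q" by (rule has_derivative_linear)
  \<comment> \<open>The two points at which \<open>G\<close> is evaluated have distances at most \<open>t * (norm a + norm b)\<close>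
    and \<open>t * norm b\<close> from \<open>x\<close>, so \<open>C * t\<close> exceeds their sum.\<close>
  define C where "C = norm a + 2 * norm b + 1"
  have C: "C > 0" unfolding C_def by (auto intro: add_nonneg_pos)
  define \<epsilon> where "\<epsilon> = e / (2 * C)"
  have \<epsilon>: "\<epsilon> > 0" using C \<open>e > 0\<close> by (simp add: \<epsilon>_def)
  obtain d where d: "d > 0" and Gd: "\<And>y. norm (y - x) < d \<Longrightarrow> norm (G y - G x - Q (y - x)) \<le> \<epsilon> * norm (y - x)"
    using Q \<epsilon> unfolding has_derivative_at_alt by blast
  obtain r where r: "r > 0" and hr: "\<And>y. dist y x < r \<Longrightarrow> h differentiable at y"
    using assms unfolding twice_diff_def eventually_nhds_metric by blast
  define m where "m = min d r / C"
  have m: "m > 0" using d r C by (simp add: m_def)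
  show "\<forall>\<^sub>F t in at_right 0. dist ((h (x + t *\<^sub>R a + t *\<^sub>R b) - h (x + t *\<^sub>R a)
            - h (x + t *\<^sub>R b) + h x) / t\<^sup>2) (hess h x a b) < e"
    unfolding eventually_at_right_field
  proof (intro exI[of _ m] conjI allI impI)
    show "0 < m" by fact
    fix t :: real assume t: "0 < t" "t < m"
    have tC: "t * C < min d r" using t C by (simp add: m_def pos_less_divide_eq)
    have bound: "norm (\<sigma> *\<^sub>R a + s *\<^sub>R b) \<le> t * (norm a + norm b)"
      if "\<sigma> \<in> {0, t}" "0 \<le> s" "s \<le> t" for s \<sigma>
    proof -
      have "norm (\<sigma> *\<^sub>R a + s *\<^sub>R b) \<le> \<bar>\<sigma>\<bar> * norm a + \<bar>s\<bar> * norm b"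
        by (metis norm_triangle_ineq norm_scaleR)
      also have "\<dots> \<le> t * norm a + t * norm b"
        using that t by (intro add_mono mult_right_mono) auto
      finally show ?thesis by (simp add: algebra_simps)
    qed
    have tC': "t * (norm a + norm b) < min d r"
    proof -
      have "t * (norm a + norm b) \<le> t * C"
        using t by (intro mult_left_mono) (auto simp: C_def)
      then show ?thesis using tC by linarith
    qed
    define \<phi> where "\<phi> s = h (x + t *\<^sub>R a + s *\<^sub>R b) - h (x + s *\<^sub>R b)" for s
    have d1: "((\<lambda>s. h (x + \<sigma> *\<^sub>R a + s *\<^sub>R b)) has_real_derivative G (x + \<sigma> *\<^sub>R a + s *\<^sub>R b)) (at s)"
      if "\<sigma> \<in> {0, t}" "0 \<le> s" "s \<le> t" for s \<sigma>
    proof -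
      let ?y = "x + \<sigma> *\<^sub>R a + s *\<^sub>R b"
      have "dist ?y x = norm (\<sigma> *\<^sub>R a + s *\<^sub>R b)"
        by (simp add: dist_norm algebra_simps)
      then have "dist ?y x < r" using bound[OF that] tC' by linarith
      then have D: "(h has_derivative frechet_derivative h (at ?y)) (at ?y)"
        using hr by (simp add: frechet_derivative_works)
      have "((\<lambda>s. x + \<sigma> *\<^sub>R a + s *\<^sub>R b) has_derivative (\<lambda>u. u *\<^sub>R b)) (at s)"
        by (auto intro!: derivative_eq_intros)
      from has_derivative_compose[OF this D]
      have "((\<lambda>s. h (x + \<sigma> *\<^sub>R a + s *\<^sub>R b)) has_derivative
             (\<lambda>u. frechet_derivative h (at ?y) (u *\<^sub>R b))) (at s)" .
      moreover have "frechet_derivative h (at ?y) (u *\<^sub>R b) = G ?y * u" for u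
        using linear_scale[OF has_derivative_linear[OF D]] by (simp add: G_def)
      ultimately show ?thesis by (simp add: has_field_derivative_def)
    qed
    have "DERIV \<phi> s :> G (x + t *\<^sub>R a + s *\<^sub>R b) - G (x + s *\<^sub>R b)" if "0 \<le> s" "s \<le> t" for s
      unfolding \<phi>_def using d1[of t s] d1[of 0 s] that by (auto intro!: DERIV_diff)
    from MVT2[OF t(1) this] obtain s where s: "0 < s" "s < t"
      and \<phi>: "\<phi> t - \<phi> 0 = t * (G (x + t *\<^sub>R a + s *\<^sub>R b) - G (x + s *\<^sub>R b))"
      by auto
    have est: "\<bar>G (x + z) - G x - Q z\<bar> \<le> \<epsilon> * norm z" if "norm z < d" for z
      using Gd[of "x + z"] that by simp
    have n1: "norm (t *\<^sub>R a + s *\<^sub>R b) \<le> t * (norm a + norm b)"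
      using bound[of t s] s by simp
    have n2: "norm (s *\<^sub>R b) \<le> t * norm b"
      using s t by (auto intro: mult_right_mono)
    have n3: "t * norm b \<le> t * (norm a + norm b)" using t by simp
    have g1: "\<bar>G (x + (t *\<^sub>R a + s *\<^sub>R b)) - G x - Q (t *\<^sub>R a + s *\<^sub>R b)\<bar> \<le> \<epsilon> * (t * (norm a + norm b))"
      by (rule order_trans[OF est]) (use n1 tC' \<epsilon> in \<open>auto intro: mult_left_mono\<close>)
    have g2: "\<bar>G (x + s *\<^sub>R b) - G x - Q (s *\<^sub>R b)\<bar> \<le> \<epsilon> * (t * norm b)"
      by (rule order_trans[OF est]) (use n2 n3 tC' \<epsilon> in \<open>auto intro!: mult_left_mono\<close>)
    have Qlin: "Q (t *\<^sub>R a + s *\<^sub>R b) = t * Q a + Q (s *\<^sub>R b)"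
      using linQ by (simp add: linear_add linear_scale)
    have "\<bar>G (x + t *\<^sub>R a + s *\<^sub>R b) - G (x + s *\<^sub>R b) - t * Q a\<bar>
        \<le> \<epsilon> * (t * (norm a + norm b)) + \<epsilon> * (t * norm b)"
      using g1 g2 Qlin by (simp add: add.assoc)
    also have "\<dots> = \<epsilon> * (C - 1) * t" by (simp add: C_def algebra_simps)
    also have "\<dots> < \<epsilon> * C * t" using \<epsilon> t by simp
    also have "\<dots> = e / 2 * t" using C by (simp add: \<epsilon>_def)
    also have "\<dots> < e * t" using \<open>e > 0\<close> t by simp
    finally have *: "\<bar>G (x + t *\<^sub>R a + s *\<^sub>R b) - G (x + s *\<^sub>R b) - t * Q a\<bar> < e * t" .
    have "(h (x + t *\<^sub>R a + t *\<^sub>R b) - h (x + t *\<^sub>R a) - h (x + t *\<^sub>R b) + h x) / t\<^sup>2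
        = (\<phi> t - \<phi> 0) / t\<^sup>2"
      by (simp add: \<phi>_def)
    also have "\<dots> = (G (x + t *\<^sub>R a + s *\<^sub>R b) - G (x + s *\<^sub>R b)) / t"
      using t by (simp add: \<phi> power2_eq_square)
    also have "\<dots> - hess h x a b = (G (x + t *\<^sub>R a + s *\<^sub>R b) - G (x + s *\<^sub>R b) - t * Q a) / t"
      using t by (simp add: hess_def Q_def G_def[abs_def] diff_divide_distrib)
    finally show "dist ((h (x + t *\<^sub>R a + t *\<^sub>R b) - h (x + t *\<^sub>R a)
            - h (x + t *\<^sub>R b) + h x) / t\<^sup>2) (hess h x a b) < e"
      using * t by (simp add: dist_real_def pos_divide_less_eq)
  qed
qed

text \<open>Schwarz's theorem: the second difference is symmetric in \<open>a\<close> and \<open>b\<close>.\<close>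

lemma hess_commute:
  assumes "twice_diff h x"
  shows "hess h x a b = hess h x b a"
proof (rule tendsto_unique[OF _ tendsto_hess[OF assms]])
  show "((\<lambda>t. (h (x + t *\<^sub>R a + t *\<^sub>R b) - h (x + t *\<^sub>R a) - h (x + t *\<^sub>R b) + h x) / t\<^sup>2)
      \<longlongrightarrow> hess h x b a) (at_right 0)"
    using tendsto_hess[OF assms, of b a] by (simp add: algebra_simps)
qed simp

lemma linear_hess:
  assumes "twice_diff h x"
  shows "linear (\<lambda>a. hess h x a b)"
  using assms unfolding twice_diff_def hess_def
  by (simp add: linear_frechet_derivative)

lemma hess_uminus:
  assumes "twice_diff h x" "twice_diff (\<lambda>y. - h y) x"
  shows "hess (\<lambda>y. - h y) x a b = - hess h x a b"
proof (rule tendsto_unique[OF _ tendsto_hess[OF assms(2)]])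
  have "((\<lambda>t. - ((h (x + t *\<^sub>R a + t *\<^sub>R b) - h (x + t *\<^sub>R a) - h (x + t *\<^sub>R b) + h x) / t\<^sup>2))
      \<longlongrightarrow> - hess h x a b) (at_right 0)"
    by (intro tendsto_minus tendsto_hess assms)
  then show "((\<lambda>t. (- h (x + t *\<^sub>R a + t *\<^sub>R b) - - h (x + t *\<^sub>R a) - - h (x + t *\<^sub>R b) + - h x) / t\<^sup>2)
      \<longlongrightarrow> - hess h x a b) (at_right 0)"
    by (simp add: minus_divide_left algebra_simps)
qed simp

text \<open>With \<open>b = - a\<close> the second difference is \<open>2 * h x - h (x + t a) - h (x - t a)\<close>, which is
  nonnegative near a maximum.\<close>

lemma hess_nonpos_at_local_max:
  assumes "twice_diff h x" and max: "\<forall>\<^sub>F y in nhds x. h y \<le> h x"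
  shows "hess h x w w \<le> 0"
proof -
  have lim: "((\<lambda>t. x + t *\<^sub>R u) \<longlongrightarrow> x) (at_right (0::real))" for u
    by (rule tendsto_eq_intros refl | simp)+
  have "\<forall>\<^sub>F t in at_right (0::real). h (x + t *\<^sub>R w) \<le> h x"
    "\<forall>\<^sub>F t in at_right (0::real). h (x + t *\<^sub>R (- w)) \<le> h x"
    using eventually_compose_filterlim[OF max lim] by blast+
  then have "\<forall>\<^sub>F t in at_right (0::real).
      0 \<le> (h (x + t *\<^sub>R w + t *\<^sub>R (- w)) - h (x + t *\<^sub>R w) - h (x + t *\<^sub>R (- w)) + h x) / t\<^sup>2"
    by eventually_elim simp
  with tendsto_hess[OF assms(1), of w "- w"] have "0 \<le> hess h x w (- w)"
    by (intro tendsto_lowerbound[where F = "at_right (0::real)"]) auto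
  also have "\<dots> = hess h x (- w) w" by (rule hess_commute[OF assms(1)])
  also have "\<dots> = - hess h x w w" by (rule linear_neg[OF linear_hess[OF assms(1)]])
  finally show ?thesis by simp
qed

lemma twice_diff_inner:
  fixes f :: "'a::euclidean_space \<Rightarrow> 'b::euclidean_space"
  assumes "open W" "x \<in> W" "Ck_open (Suc (Suc 0)) W f"
  shows "twice_diff (\<lambda>y. n \<bullet> f y) x"
    and "((\<lambda>y. n \<bullet> frechet_derivative f (at y) b) has_derivative (\<lambda>a. hess (\<lambda>y. n \<bullet> f y) x a b)) (at x)"
proof -
  have f: "(f has_derivative frechet_derivative f (at y)) (at y)" if "y \<in> W" for y
    using assms that by (simp add: frechet_derivative_works)
  have h: "((\<lambda>y. n \<bullet> f y) has_derivative (\<lambda>b. n \<bullet> frechet_derivative f (at y) b)) (at y)" if "y \<in> W" for y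
    by (intro has_derivative_inner_right f that)
  have hD: "frechet_derivative (\<lambda>y. n \<bullet> f y) (at y) b = n \<bullet> frechet_derivative f (at y) b" if "y \<in> W" for y b
    using frechet_derivative_at[OF h[OF that]] by metis
  define S where "S b = frechet_derivative (\<lambda>y. frechet_derivative f (at y) b) (at x)" for b
  have S: "((\<lambda>y. n \<bullet> frechet_derivative f (at y) b) has_derivative (\<lambda>a. n \<bullet> S b a)) (at x)" for b
    unfolding S_def using assms
    by (intro has_derivative_inner_right) (simp add: frechet_derivative_works[symmetric])
  then have S': "((\<lambda>y. frechet_derivative (\<lambda>y. n \<bullet> f y) (at y) b) has_derivative (\<lambda>a. n \<bullet> S b a)) (at x)" for b
    by (rule has_derivative_transform_within_open[OF _ assms(1,2)]) (simp add: hD)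
  have "\<forall>\<^sub>F y in nhds x. y \<in> W"
    using assms(1,2) eventually_nhds_in_open by blast
  then have "\<forall>\<^sub>F y in nhds x. (\<lambda>y. n \<bullet> f y) differentiable at y"
    by eventually_elim (use h differentiableI in blast)
  then show "twice_diff (\<lambda>y. n \<bullet> f y) x"
    unfolding twice_diff_def using S' differentiableI by blast
  have "(\<lambda>a. hess (\<lambda>y. n \<bullet> f y) x a b) = (\<lambda>a. n \<bullet> S b a)"
    unfolding hess_def using frechet_derivative_at[OF S'] by metis
  with S show "((\<lambda>y. n \<bullet> frechet_derivative f (at y) b) has_derivative (\<lambda>a. hess (\<lambda>y. n \<bullet> f y) x a b)) (at x)"
    by simp
qed

section \<open>Linear algebra of the shape operator\<close>

text \<open>A nonzero remainder \<open>r\<close> would be a fourth orthogonal direction in a three-dimensional space.\<close>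

lemma orthonormal_expansion3:
  fixes n e\<^sub>1 e\<^sub>2 u :: "real^3"
  assumes "norm n = 1" "norm e\<^sub>1 = 1" "norm e\<^sub>2 = 1" "n \<bullet> e\<^sub>1 = 0" "n \<bullet> e\<^sub>2 = 0" "e\<^sub>1 \<bullet> e\<^sub>2 = 0"
  shows "u = (u \<bullet> n) *\<^sub>R n + (u \<bullet> e\<^sub>1) *\<^sub>R e\<^sub>1 + (u \<bullet> e\<^sub>2) *\<^sub>R e\<^sub>2"
proof (rule ccontr)
  define r where "r = u - ((u \<bullet> n) *\<^sub>R n + (u \<bullet> e\<^sub>1) *\<^sub>R e\<^sub>1 + (u \<bullet> e\<^sub>2) *\<^sub>R e\<^sub>2)"
  assume "\<not> ?thesis"
  then have r0: "r \<noteq> 0" by (simp add: r_def)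
  have sq: "n \<bullet> n = 1" "e\<^sub>1 \<bullet> e\<^sub>1 = 1" "e\<^sub>2 \<bullet> e\<^sub>2 = 1" using assms by (auto simp: norm_eq_1)
  have r: "r \<bullet> n = 0" "r \<bullet> e\<^sub>1 = 0" "r \<bullet> e\<^sub>2 = 0"
    using sq assms by (auto simp: r_def inner_diff_left inner_add_left inner_commute[of e\<^sub>1 n]
        inner_commute[of e\<^sub>2 n] inner_commute[of e\<^sub>2 e\<^sub>1])
  let ?S = "{r, n, e\<^sub>1, e\<^sub>2}"
  have ne: "r \<noteq> n" "r \<noteq> e\<^sub>1" "r \<noteq> e\<^sub>2" "n \<noteq> e\<^sub>1" "n \<noteq> e\<^sub>2" "e\<^sub>1 \<noteq> e\<^sub>2"
    using sq r assms by auto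
  have "pairwise orthogonal ?S"
    using r assms by (auto simp: pairwise_def orthogonal_def inner_commute)
  moreover have "0 \<notin> ?S" using r0 assms by auto
  ultimately have "independent ?S" by (rule pairwise_orthogonal_independent)
  then have "card ?S \<le> 3" using independent_card_le[of ?S] by simp
  then show False using ne by simp
qed

text \<open>In the next lemmas \<open>A\<close> and \<open>D\<close> stand for \<open>dX\<close> and \<open>dN\<close> at a point, read in a chart.
  The vectors \<open>A w\<^sub>1, A w\<^sub>2\<close> form an orthonormal eigenbasis of the operator that sends \<open>A w\<close>
  to \<open>- D w\<close>.\<close>

definition principal_frame ::
    "(real^2 \<Rightarrow> real^3) \<Rightarrow> (real^2 \<Rightarrow> real^3) \<Rightarrow> real \<Rightarrow> real \<Rightarrow> real^2 \<Rightarrow> real^2 \<Rightarrow> bool" where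
  "principal_frame A D \<kappa>\<^sub>1 \<kappa>\<^sub>2 w\<^sub>1 w\<^sub>2 \<longleftrightarrow> norm (A w\<^sub>1) = 1 \<and> norm (A w\<^sub>2) = 1 \<and> A w\<^sub>1 \<bullet> A w\<^sub>2 = 0 \<and>
     - D w\<^sub>1 = \<kappa>\<^sub>1 *\<^sub>R A w\<^sub>1 \<and> - D w\<^sub>2 = \<kappa>\<^sub>2 *\<^sub>R A w\<^sub>2"

lemma ex_orthonormal_image:
  fixes A :: "real^2 \<Rightarrow> real^3"
  assumes "linear A" "inj A"
  obtains e\<^sub>1 e\<^sub>2 where "norm (A e\<^sub>1) = 1" "norm (A e\<^sub>2) = 1" "A e\<^sub>1 \<bullet> A e\<^sub>2 = 0"
proof -
  interpret linear A by fact
  define i :: "real^2" where "i = axis 1 1"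
  define j :: "real^2" where "j = axis 2 1"
  have A0: "A w = 0 \<longleftrightarrow> w = 0" for w using assms(2) by (metis inj_def zero)
  define k where "k = j - ((A j \<bullet> A i) / (A i \<bullet> A i)) *\<^sub>R i"
  have "i $ 1 = 1" "k $ 2 = 1" by (auto simp: i_def j_def k_def axis_def)
  then have "i \<noteq> 0" "k \<noteq> 0" by (metis zero_index zero_neq_one)+
  then have nz: "A i \<noteq> 0" "A k \<noteq> 0" using A0 by auto
  have ik: "A i \<bullet> A k = 0"
    using nz by (simp add: k_def diff scale inner_diff_right inner_commute)
  show ?thesis
    by (rule that[of "inverse (norm (A i)) *\<^sub>R i" "inverse (norm (A k)) *\<^sub>R k"])
      (use nz ik in \<open>auto simp: scale\<close>)
qed

text \<open>Spectral theorem in dimension two. For the orthonormal basis obtained from a fixed one by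
  rotation through \<open>t\<close>, the off-diagonal entry \<open>\<beta> t\<close> of the form changes sign between \<open>t = 0\<close> and
  \<open>t = pi/2\<close>, by symmetry; at a zero of \<open>\<beta>\<close> the form is diagonal.\<close>

lemma ex_principal_frame:
  fixes A D :: "real^2 \<Rightarrow> real^3"
  assumes "linear A" "inj A" "linear D" "norm n = 1"
    and nA: "\<And>w. n \<bullet> A w = 0" and nD: "\<And>w. n \<bullet> D w = 0"
    and sym: "\<And>a b. D a \<bullet> A b = D b \<bullet> A a"
  obtains \<kappa>\<^sub>1 \<kappa>\<^sub>2 w\<^sub>1 w\<^sub>2 where "principal_frame A D \<kappa>\<^sub>1 \<kappa>\<^sub>2 w\<^sub>1 w\<^sub>2"
proof -
  interpret A: linear A by fact
  interpret D: linear D by fact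
  obtain e\<^sub>1 e\<^sub>2 where e: "norm (A e\<^sub>1) = 1" "norm (A e\<^sub>2) = 1" "A e\<^sub>1 \<bullet> A e\<^sub>2 = 0"
    using ex_orthonormal_image assms by blast
  define u where "u t = cos t *\<^sub>R e\<^sub>1 + sin t *\<^sub>R e\<^sub>2" for t :: real
  define v where "v t = - sin t *\<^sub>R e\<^sub>1 + cos t *\<^sub>R e\<^sub>2" for t :: real
  define \<beta> where "\<beta> t = D (u t) \<bullet> A (v t)" for t
  have "continuous_on {0..pi/2} \<beta>"
    unfolding \<beta>_def u_def v_def A.add A.scale D.add D.scale by (intro continuous_intros)
  moreover have "\<beta> 0 = D e\<^sub>1 \<bullet> A e\<^sub>2" "\<beta> (pi/2) = - (D e\<^sub>1 \<bullet> A e\<^sub>2)"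
    by (auto simp: \<beta>_def u_def v_def A.neg sym[of e\<^sub>2 e\<^sub>1])
  ultimately obtain t where t: "\<beta> t = 0"
    using IVT'[of \<beta> 0 0 "pi/2"] IVT2'[of \<beta> "pi/2" 0 0] by (metis linorder_linear neg_0_le_iff_le neg_le_0_iff_le pi_half_ge_zero)
  have sq: "A e\<^sub>1 \<bullet> A e\<^sub>1 = 1" "A e\<^sub>2 \<bullet> A e\<^sub>2 = 1" using e by (auto simp: norm_eq_1)
  define w\<^sub>1 where "w\<^sub>1 = u t"
  define w\<^sub>2 where "w\<^sub>2 = v t"
  have sc: "cos t * cos t + sin t * sin t = 1"
    by (metis power2_eq_square sin_cos_squared_add2)
  have w: "norm (A w\<^sub>1) = 1" "norm (A w\<^sub>2) = 1" "A w\<^sub>1 \<bullet> A w\<^sub>2 = 0"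
    using sq e(3) sc
    by (auto simp: norm_eq_1 w\<^sub>1_def w\<^sub>2_def u_def v_def A.add A.diff A.scale
        inner_add_left inner_add_right inner_diff_left inner_diff_right inner_commute add.commute)
  have off: "D w\<^sub>1 \<bullet> A w\<^sub>2 = 0" "D w\<^sub>2 \<bullet> A w\<^sub>1 = 0"
    using t sym[of w\<^sub>2 w\<^sub>1] by (auto simp: \<beta>_def w\<^sub>1_def w\<^sub>2_def)
  have exp: "z = (z \<bullet> n) *\<^sub>R n + (z \<bullet> A w\<^sub>1) *\<^sub>R A w\<^sub>1 + (z \<bullet> A w\<^sub>2) *\<^sub>R A w\<^sub>2" for z
    by (rule orthonormal_expansion3) (use w assms in auto)
  show ?thesis
  proof
    show "principal_frame A D (- (D w\<^sub>1 \<bullet> A w\<^sub>1)) (- (D w\<^sub>2 \<bullet> A w\<^sub>2)) w\<^sub>1 w\<^sub>2"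
      unfolding principal_frame_def
      using w exp[of "D w\<^sub>1"] exp[of "D w\<^sub>2"] off nD by (simp add: inner_commute)
  qed
qed

text \<open>The squared entries \<open>c\<^sub>i\<^sub>j\<close> of the orthogonal matrix that relates the two frames satisfy
  \<open>\<mu>\<^sub>i = \<kappa>\<^sub>1 * c\<^sub>i\<^sub>1 + \<kappa>\<^sub>2 * c\<^sub>i\<^sub>2\<close>, and its columns are unit vectors: \<open>c\<^sub>1\<^sub>j + c\<^sub>2\<^sub>j = 1\<close>.\<close>

lemma principal_frame_trace_unique:
  fixes A D :: "real^2 \<Rightarrow> real^3"
  assumes "linear A" "inj A" "linear D" "norm n = 1" and nA: "\<And>w. n \<bullet> A w = 0"
    and F: "principal_frame A D \<kappa>\<^sub>1 \<kappa>\<^sub>2 w\<^sub>1 w\<^sub>2" and G: "principal_frame A D \<mu>\<^sub>1 \<mu>\<^sub>2 z\<^sub>1 z\<^sub>2"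
  shows "\<kappa>\<^sub>1 + \<kappa>\<^sub>2 = \<mu>\<^sub>1 + \<mu>\<^sub>2"
proof -
  interpret A: linear A by fact
  interpret D: linear D by fact
  have expand: "A z = (A z \<bullet> A y\<^sub>1) *\<^sub>R A y\<^sub>1 + (A z \<bullet> A y\<^sub>2) *\<^sub>R A y\<^sub>2"
    if "principal_frame A D k\<^sub>1 k\<^sub>2 y\<^sub>1 y\<^sub>2" for k\<^sub>1 k\<^sub>2 y\<^sub>1 y\<^sub>2 z
    using orthonormal_expansion3[of n "A y\<^sub>1" "A y\<^sub>2" "A z"] that assms
    by (simp add: principal_frame_def inner_commute)
  have one: "(A z \<bullet> A y\<^sub>1)\<^sup>2 + (A z \<bullet> A y\<^sub>2)\<^sup>2 = 1"
    if "principal_frame A D k\<^sub>1 k\<^sub>2 y\<^sub>1 y\<^sub>2" "norm (A z) = 1" for k\<^sub>1 k\<^sub>2 y\<^sub>1 y\<^sub>2 z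
  proof -
    have "A z \<bullet> A z = (A z \<bullet> A y\<^sub>1) * (A z \<bullet> A y\<^sub>1) + (A z \<bullet> A y\<^sub>2) * (A z \<bullet> A y\<^sub>2)"
      by (subst (2) expand[OF that(1)]) (simp add: inner_add_right)
    then show ?thesis using that(2) by (simp add: norm_eq_1 power2_eq_square)
  qed
  have \<mu>: "\<mu> = \<kappa>\<^sub>1 * (A z \<bullet> A w\<^sub>1)\<^sup>2 + \<kappa>\<^sub>2 * (A z \<bullet> A w\<^sub>2)\<^sup>2"
    if "norm (A z) = 1" "- D z = \<mu> *\<^sub>R A z" for z \<mu>
  proof -
    define a b where "a = A z \<bullet> A w\<^sub>1" and "b = A z \<bullet> A w\<^sub>2"
    have "A z = A (a *\<^sub>R w\<^sub>1 + b *\<^sub>R w\<^sub>2)"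
      using expand[OF F, of z] by (simp add: A.add A.scale a_def b_def)
    then have "z = a *\<^sub>R w\<^sub>1 + b *\<^sub>R w\<^sub>2" using assms(2) by (simp add: inj_eq)
    then have "- D z = a *\<^sub>R (- D w\<^sub>1) + b *\<^sub>R (- D w\<^sub>2)" by (simp add: D.add D.scale)
    also have "\<dots> = (a * \<kappa>\<^sub>1) *\<^sub>R A w\<^sub>1 + (b * \<kappa>\<^sub>2) *\<^sub>R A w\<^sub>2"
      using F unfolding principal_frame_def by (metis scaleR_scaleR)
    finally have "A z \<bullet> (\<mu> *\<^sub>R A z) = A z \<bullet> ((a * \<kappa>\<^sub>1) *\<^sub>R A w\<^sub>1 + (b * \<kappa>\<^sub>2) *\<^sub>R A w\<^sub>2)"
      using that(2) by simp
    then show ?thesis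
      using that(1) by (simp add: inner_add_right norm_eq_1 a_def b_def power2_eq_square algebra_simps)
  qed
  have "\<mu>\<^sub>1 + \<mu>\<^sub>2 = \<kappa>\<^sub>1 * ((A w\<^sub>1 \<bullet> A z\<^sub>1)\<^sup>2 + (A w\<^sub>1 \<bullet> A z\<^sub>2)\<^sup>2) + \<kappa>\<^sub>2 * ((A w\<^sub>2 \<bullet> A z\<^sub>1)\<^sup>2 + (A w\<^sub>2 \<bullet> A z\<^sub>2)\<^sup>2)"
    using \<mu>[of z\<^sub>1 \<mu>\<^sub>1] \<mu>[of z\<^sub>2 \<mu>\<^sub>2] G by (simp add: principal_frame_def inner_commute algebra_simps)
  also have "\<dots> = \<kappa>\<^sub>1 + \<kappa>\<^sub>2"
    using one[OF G] F by (simp add: principal_frame_def)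
  finally show ?thesis by simp
qed

section \<open>Charts at interior points\<close>

text \<open>Chart images are relatively open in the closed half-plane. Away from the bounding line they
  are therefore neighbourhoods in the whole plane, and ordinary derivatives are available.\<close>

lemma chart_interior:
  assumes "is_chart M c" "openin M V" "V \<subseteq> fst c" "p \<in> V" "snd c p $ 2 \<noteq> 0"
  shows "snd c p \<in> interior (snd c ` V)"
proof -
  obtain U \<phi> where c: "c = (U, \<phi>)" by fastforce
  have U: "openin M U" "openin (top_of_set half_plane) (\<phi> ` U)"
    "homeomorphic_map (subtopology M U) (top_of_set (\<phi> ` U)) \<phi>"
    using assms(1) by (auto simp: is_chart_def c)
  have "openin (subtopology M U) V"
    using assms(2,3) U(1) by (simp add: c openin_open_subtopology)
  then have "openin (top_of_set (\<phi> ` U)) (\<phi> ` V)"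
    using homeomorphic_imp_open_map[OF U(3)] by (simp add: open_map_def)
  then have "openin (top_of_set half_plane) (\<phi> ` V)"
    using U(2) openin_trans by blast
  then obtain T where T: "open T" "\<phi> ` V = half_plane \<inter> T"
    by (auto simp: openin_open)
  have "\<phi> p \<in> half_plane \<inter> T" using T assms(4) by blast
  then have "\<phi> p \<in> {z. z $ 2 > 0} \<inter> T"
    using assms(5) by (auto simp: half_plane_def c)
  moreover have "open ({z::real^2. z $ 2 > 0} \<inter> T)"
    using T(1) open_halfspace_component_gt_cart by blast
  moreover have "{z. z $ 2 > 0} \<inter> T \<subseteq> \<phi> ` V"
    using T(2) by (auto simp: half_plane_def)
  ultimately show ?thesis
    unfolding c by (metis interiorI snd_conv)
qed

lemma chart_inj: "is_chart M c \<Longrightarrow> inj_on (snd c) (fst c)"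
  using homeomorphic_imp_injective_map openin_subset[of M "fst c"]
  by (cases c) (fastforce simp: is_chart_def Int_absorb1)

lemma in_chart_apply:
  assumes "is_chart M c" "p \<in> fst c"
  shows "in_chart c F (snd c p) = F p"
  using assms chart_inj[OF assms(1)] by (cases c) (simp add: in_chart_def the_inv_into_f_f)

lemma diff_at_interior:
  assumes "snd c p \<in> interior (snd c ` fst c)"
  shows "diff_at c F p = frechet_derivative (in_chart c F) (at (snd c p))"
  unfolding diff_at_def by (simp add: at_within_interior[OF assms])

locale surface =
  fixes M :: "'a topology" and \<A> :: "'a chart set"
  assumes surf: "smooth_surface M \<A>"
begin

lemma chart: "c \<in> \<A> \<Longrightarrow> is_chart M c"
  using surf by (auto simp: smooth_surface_def)

lemma ex_chart:
  assumes "p \<in> topspace M"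
  obtains c where "c \<in> \<A>" "p \<in> fst c"
  using surf assms unfolding smooth_surface_def by blast

lemma chart_open: "c \<in> \<A> \<Longrightarrow> openin M (fst c)"
  using chart[of c] by (auto simp: is_chart_def split: prod.splits)

lemma interior_mem:
  assumes "p \<in> surface_interior M \<A>" "c \<in> \<A>" "openin M V" "p \<in> V" "V \<subseteq> fst c"
  shows "snd c p \<in> interior (snd c ` V)"
  by (rule chart_interior[OF chart])
    (use assms in \<open>auto simp: surface_interior_def surface_boundary_def\<close>)

lemma has_derivative_in_chart:
  assumes "smooth_function \<A> F" "p \<in> surface_interior M \<A>" "c \<in> \<A>" "p \<in> fst c"
  shows "(in_chart c F has_derivative diff_at c F p) (at (snd c p))"
proof -
  have int: "snd c p \<in> interior (snd c ` fst c)"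
    using interior_mem assms chart_open by blast
  have "in_chart c F differentiable at (snd c p)"
    using assms int by (auto simp: smooth_function_def intro: smooth_on_differentiable)
  then show ?thesis
    by (simp add: diff_at_interior[OF int] frechet_derivative_works)
qed

text \<open>The linear map \<open>diff_at d (snd c) p\<close> that relates the two charts is the same for every \<open>F\<close>.
  Applied to \<open>X\<close> and to \<open>N\<close>, this carries a principal frame from one chart to another.\<close>

lemma diff_at_change_chart:
  assumes "smooth_function \<A> F" "p \<in> surface_interior M \<A>"
    and "c \<in> \<A>" "p \<in> fst c" "d \<in> \<A>" "p \<in> fst d"
  shows "diff_at d F p w = diff_at c F p (diff_at d (snd c) p w)"
proof -
  let ?V = "fst c \<inter> fst d"
  have oV: "openin M ?V" using chart_open assms by blast
  have int: "snd d p \<in> interior (snd d ` ?V)"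
    using interior_mem[of p d ?V] oV assms by auto
  have intd: "snd d p \<in> interior (snd d ` fst d)"
    using interior_mem[of p d "fst d"] chart_open assms by auto
  have "smooth_on (snd d ` ?V) (in_chart d (snd c))"
    using surf assms unfolding smooth_surface_def by (metis Int_commute)
  then have "in_chart d (snd c) differentiable at (snd d p)"
    using int by (rule smooth_on_differentiable)
  then have T: "(in_chart d (snd c) has_derivative diff_at d (snd c) p) (at (snd d p))"
    by (simp add: diff_at_interior[OF intd] frechet_derivative_works)
  have eq: "in_chart d (snd c) (snd d p) = snd c p"
    using in_chart_apply[OF chart[OF assms(5)] assms(6)] .
  have C: "(in_chart c F has_derivative diff_at c F p) (at (in_chart d (snd c) (snd d p)))"
    unfolding eq by (rule has_derivative_in_chart) (use assms in auto)
  have "((\<lambda>y. in_chart c F (in_chart d (snd c) y)) has_derivative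
      (\<lambda>w. diff_at c F p (diff_at d (snd c) p w))) (at (snd d p))"
    by (rule has_derivative_compose[OF T C])
  then have "(in_chart d F has_derivative
      (\<lambda>w. diff_at c F p (diff_at d (snd c) p w))) (at (snd d p))"
  proof (rule has_derivative_transform_within_open[OF _ open_interior int])
    fix y assume "y \<in> interior (snd d ` ?V)"
    then obtain q where q: "q \<in> ?V" "y = snd d q" using interior_subset by blast
    then show "in_chart c F (in_chart d (snd c) y) = in_chart d F y"
      using in_chart_apply[OF chart[OF assms(5)], of q "snd c"]
        in_chart_apply[OF chart[OF assms(5)], of q F]
        in_chart_apply[OF chart[OF assms(3)], of q F] by simp
  qed
  then show ?thesis
    using has_derivative_unique[OF has_derivative_in_chart[OF assms(1,2,5,6)]] by metis
qed

lemma continuous_map_smooth_function: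
  assumes "smooth_function \<A> F"
  shows "continuous_map M euclidean F"
proof (rule pasting_lemma[where I = \<A> and T = fst and f = "\<lambda>_. F"])
  show "openin M (fst c)" if "c \<in> \<A>" for c using that by (rule chart_open)
  show "\<exists>c. c \<in> \<A> \<and> p \<in> fst c \<and> F p = F p" if "p \<in> topspace M" for p
    using that ex_chart by metis
  show "continuous_map (subtopology M (fst c)) euclidean F" if c: "c \<in> \<A>" for c
  proof (rule continuous_map_eq)
    have "continuous_on (snd c ` fst c) (in_chart c F)"
      using assms c by (auto simp: smooth_function_def intro: smooth_on_imp_continuous_on)
    then have "continuous_map (top_of_set (snd c ` fst c)) euclidean (in_chart c F)"
      by simp
    moreover have "continuous_map (subtopology M (fst c)) (top_of_set (snd c ` fst c)) (snd c)"
      using chart[OF c] by (auto simp: is_chart_def intro: homeomorphic_imp_continuous_map split: prod.splits)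
    ultimately show "continuous_map (subtopology M (fst c)) euclidean (in_chart c F \<circ> snd c)"
      by (rule continuous_map_compose[rotated])
    show "(in_chart c F \<circ> snd c) p = F p" if "p \<in> topspace (subtopology M (fst c))" for p
      using that in_chart_apply[OF chart[OF c], of p F] by simp
  qed
qed auto

end

section \<open>Mean curvature as the trace of a Hessian\<close>

locale immersed_surface = surface M \<A> for M :: "'a topology" and \<A> +
  fixes X N :: "'a \<Rightarrow> real^3"
  assumes imm: "immersion \<A> X" and gauss: "gauss_map \<A> X N"
begin

lemma smooth_X: "smooth_function \<A> X" and smooth_N: "smooth_function \<A> N"
  using imm gauss by (auto simp: immersion_def gauss_map_def)

lemma norm_N: "c \<in> \<A> \<Longrightarrow> p \<in> fst c \<Longrightarrow> norm (N p) = 1"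
  using gauss by (force simp: gauss_map_def)

lemma N_orthogonal: "c \<in> \<A> \<Longrightarrow> p \<in> fst c \<Longrightarrow> N p \<bullet> diff_at c X p w = 0"
  using gauss by (auto simp: gauss_map_def)

text \<open>The last two facts come from differentiating identities that hold in a whole neighbourhood of
  \<open>p\<close>: \<open>\<langle>N, N\<rangle> = 1\<close> for the second and \<open>\<langle>N, dX(b)\<rangle> = 0\<close> for the third, where the term
  \<open>\<langle>N p, d(dX(b))(a)\<rangle>\<close> is the Hessian of the height in the fixed direction \<open>N p\<close>.\<close>

lemma
  assumes "p \<in> surface_interior M \<A>" "c \<in> \<A>" "p \<in> fst c"
  shows twice_diff_height: "twice_diff (\<lambda>y. n \<bullet> in_chart c X y) (snd c p)"
    and N_orthogonal_diff_N: "N p \<bullet> diff_at c N p a = 0"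
    and second_fundamental_form:
      "diff_at c N p a \<bullet> diff_at c X p b = - hess (\<lambda>y. N p \<bullet> in_chart c X y) (snd c p) a b"
proof -
  let ?x = "snd c p" and ?f = "in_chart c X" and ?n = "in_chart c N"
  have int: "?x \<in> interior (snd c ` fst c)"
    using interior_mem[OF assms(1,2) chart_open[OF assms(2)] assms(3)] by simp
  have "smooth_on (snd c ` fst c) ?f"
    using smooth_X assms(2) by (simp add: smooth_function_def)
  then obtain W where W: "open W" "?x \<in> W" "W \<subseteq> snd c ` fst c" "\<And>k. Ck_open k W ?f"
    using smooth_on_interiorE int by metis
  show "twice_diff (\<lambda>y. n \<bullet> in_chart c X y) (snd c p)"
    using twice_diff_inner(1)[OF W(1,2,4)] .
  have nx: "?n ?x = N p" using in_chart_apply[OF chart[OF assms(2)] assms(3)] .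
  have dn: "(?n has_derivative diff_at c N p) (at ?x)"
    by (rule has_derivative_in_chart[OF smooth_N assms])
  have orth: "norm (?n y) = 1" "?n y \<bullet> frechet_derivative ?f (at y) b = 0" if "y \<in> W" for y b
  proof -
    obtain q where q: "q \<in> fst c" "y = snd c q" using W(3) \<open>y \<in> W\<close> by blast
    have "y \<in> interior (snd c ` fst c)" using W(1,3) that by (meson interiorI)
    then have "frechet_derivative ?f (at y) = diff_at c X q"
      using diff_at_interior[of c q X] q by simp
    moreover have "?n y = N q" using q in_chart_apply[OF chart[OF assms(2)]] by blast
    ultimately show "norm (?n y) = 1" "?n y \<bullet> frechet_derivative ?f (at y) b = 0"
      using norm_N N_orthogonal q assms(2) by auto
  qed
  have zero: "D = (\<lambda>_. 0)" if "(g has_derivative D) (at ?x)" "\<And>y. y \<in> W \<Longrightarrow> g y = k" for g :: "_ \<Rightarrow> real" and D k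
  proof -
    have "((\<lambda>_. k) has_derivative D) (at ?x)"
      using has_derivative_transform_within_open[OF that(1) W(1,2)] that(2) by simp
    then show ?thesis using has_derivative_unique has_derivative_const by blast
  qed
  have "((\<lambda>y. ?n y \<bullet> ?n y) has_derivative (\<lambda>a. ?n ?x \<bullet> diff_at c N p a + diff_at c N p a \<bullet> ?n ?x)) (at ?x)"
    by (rule has_derivative_inner[OF dn dn])
  from zero[OF this, of 1] have "?n ?x \<bullet> diff_at c N p a + diff_at c N p a \<bullet> ?n ?x = 0"
    using orth(1) by (simp add: norm_eq_1 fun_eq_iff)
  then show "N p \<bullet> diff_at c N p a = 0" by (simp add: nx inner_commute)
  let ?A = "\<lambda>y. frechet_derivative ?f (at y) b" and ?H = "hess (\<lambda>y. N p \<bullet> ?f y) ?x a b"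
  define S where "S = frechet_derivative ?A (at ?x)"
  have "Ck_open (Suc (Suc 0)) W ?f" by (rule W)
  then have dA: "(?A has_derivative S) (at ?x)"
    using W(2) unfolding S_def frechet_derivative_works[symmetric] by simp
  have "((\<lambda>y. ?n y \<bullet> ?A y) has_derivative (\<lambda>a. ?n ?x \<bullet> S a + diff_at c N p a \<bullet> ?A ?x)) (at ?x)"
    by (rule has_derivative_inner[OF dn dA])
  from zero[OF this, of 0] have "?n ?x \<bullet> S a + diff_at c N p a \<bullet> ?A ?x = 0"
    using orth(2) by (simp add: fun_eq_iff)
  moreover have "N p \<bullet> S a = ?H"
    using has_derivative_unique[OF has_derivative_inner_right[OF dA, of "N p"]
        twice_diff_inner(2)[OF W(1,2,4), of "N p" b]] by metis
  ultimately show "diff_at c N p a \<bullet> diff_at c X p b = - ?H"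
    by (simp add: nx diff_at_interior[OF int, of X])
qed

text \<open>The definite description defining the mean curvature ranges over the eigenbases of all charts
  around \<open>p\<close>. A change of chart moves each of them into the chart \<open>c\<close>, where one exists and the
  trace is unique.\<close>

lemma mean_curvature_eq_hess_trace:
  assumes "p \<in> surface_interior M \<A>" "c \<in> \<A>" "p \<in> fst c"
  defines "B \<equiv> hess (\<lambda>y. N p \<bullet> in_chart c X y) (snd c p)"
  obtains w\<^sub>1 w\<^sub>2 where "norm (diff_at c X p w\<^sub>1) = 1" "norm (diff_at c X p w\<^sub>2) = 1"
    "diff_at c X p w\<^sub>1 \<bullet> diff_at c X p w\<^sub>2 = 0"
    "mean_curvature \<A> X N p = (B w\<^sub>1 w\<^sub>1 + B w\<^sub>2 w\<^sub>2) / 2"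
proof -
  let ?A = "diff_at c X p" and ?D = "diff_at c N p"
  have lin: "linear ?A" "linear ?D"
    using has_derivative_in_chart[OF smooth_X assms(1-3)] has_derivative_in_chart[OF smooth_N assms(1-3)]
      has_derivative_linear by blast+
  have inj: "inj ?A" using imm assms by (auto simp: immersion_def)
  have n: "norm (N p) = 1" "\<And>w. N p \<bullet> ?A w = 0" "\<And>w. N p \<bullet> ?D w = 0"
    using norm_N N_orthogonal N_orthogonal_diff_N assms by auto
  have II: "?D a \<bullet> ?A b = - B a b" for a b
    unfolding B_def by (rule second_fundamental_form[OF assms(1-3)])
  have "B a b = B b a" for a b
    unfolding B_def by (rule hess_commute[OF twice_diff_height[OF assms(1-3)]])
  then have "?D a \<bullet> ?A b = ?D b \<bullet> ?A a" for a b by (simp add: II)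
  then obtain \<kappa>\<^sub>1 \<kappa>\<^sub>2 w\<^sub>1 w\<^sub>2 where F: "principal_frame ?A ?D \<kappa>\<^sub>1 \<kappa>\<^sub>2 w\<^sub>1 w\<^sub>2"
    using ex_principal_frame[OF lin(1) inj lin(2) n] by metis
  have pc: "principal_curvatures \<A> X N p \<mu>\<^sub>1 \<mu>\<^sub>2 \<longleftrightarrow> (\<exists>z\<^sub>1 z\<^sub>2. principal_frame ?A ?D \<mu>\<^sub>1 \<mu>\<^sub>2 z\<^sub>1 z\<^sub>2)"
    for \<mu>\<^sub>1 \<mu>\<^sub>2
  proof
    assume "principal_curvatures \<A> X N p \<mu>\<^sub>1 \<mu>\<^sub>2"
    then obtain d z\<^sub>1 z\<^sub>2 where d: "d \<in> \<A>" "p \<in> fst d"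
      and z: "principal_frame (diff_at d X p) (diff_at d N p) \<mu>\<^sub>1 \<mu>\<^sub>2 z\<^sub>1 z\<^sub>2"
      unfolding principal_curvatures_def principal_frame_def by blast
    have "principal_frame ?A ?D \<mu>\<^sub>1 \<mu>\<^sub>2 (diff_at d (snd c) p z\<^sub>1) (diff_at d (snd c) p z\<^sub>2)"
      using z diff_at_change_chart[OF smooth_X assms(1-3) d]
        diff_at_change_chart[OF smooth_N assms(1-3) d]
      by (simp add: principal_frame_def)
    then show "\<exists>z\<^sub>1 z\<^sub>2. principal_frame ?A ?D \<mu>\<^sub>1 \<mu>\<^sub>2 z\<^sub>1 z\<^sub>2" by blast
  next
    assume "\<exists>z\<^sub>1 z\<^sub>2. principal_frame ?A ?D \<mu>\<^sub>1 \<mu>\<^sub>2 z\<^sub>1 z\<^sub>2"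
    then show "principal_curvatures \<A> X N p \<mu>\<^sub>1 \<mu>\<^sub>2"
      using assms(2,3) unfolding principal_curvatures_def principal_frame_def by blast
  qed
  have "mean_curvature \<A> X N p = (\<kappa>\<^sub>1 + \<kappa>\<^sub>2) / 2"
    unfolding mean_curvature_def pc
  proof (rule the_equality)
    show "\<exists>\<mu>\<^sub>1 \<mu>\<^sub>2. (\<exists>z\<^sub>1 z\<^sub>2. principal_frame ?A ?D \<mu>\<^sub>1 \<mu>\<^sub>2 z\<^sub>1 z\<^sub>2) \<and> (\<kappa>\<^sub>1 + \<kappa>\<^sub>2) / 2 = (\<mu>\<^sub>1 + \<mu>\<^sub>2) / 2"
      using F by blast
    show "H = (\<kappa>\<^sub>1 + \<kappa>\<^sub>2) / 2"
      if "\<exists>\<mu>\<^sub>1 \<mu>\<^sub>2. (\<exists>z\<^sub>1 z\<^sub>2. principal_frame ?A ?D \<mu>\<^sub>1 \<mu>\<^sub>2 z\<^sub>1 z\<^sub>2) \<and> H = (\<mu>\<^sub>1 + \<mu>\<^sub>2) / 2" for H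
      using that principal_frame_trace_unique[OF lin(1) inj lin(2) n(1,2) F] by metis
  qed
  moreover have "\<kappa>\<^sub>1 = B w\<^sub>1 w\<^sub>1" "\<kappa>\<^sub>2 = B w\<^sub>2 w\<^sub>2"
  proof -
    have "- (?D w\<^sub>1) \<bullet> ?A w\<^sub>1 = \<kappa>\<^sub>1" "- (?D w\<^sub>2) \<bullet> ?A w\<^sub>2 = \<kappa>\<^sub>2"
      using F unfolding principal_frame_def by (metis inner_scaleR_left mult.right_neutral norm_eq_1)+
    then show "\<kappa>\<^sub>1 = B w\<^sub>1 w\<^sub>1" "\<kappa>\<^sub>2 = B w\<^sub>2 w\<^sub>2" by (simp_all add: II)
  qed
  ultimately show ?thesis
    using F by (intro that[of w\<^sub>1 w\<^sub>2]) (auto simp: principal_frame_def)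
qed

section \<open>Highest points\<close>

text \<open>At a highest point \<open>v\<close> is orthogonal to the tangent plane, so \<open>N p = \<plusminus> v\<close>. The Hessian that
  computes the mean curvature is then \<open>\<plusminus>\<close> the Hessian of the height \<open>\<langle>X, v\<rangle>\<close>, which is nonpositive.\<close>

lemma interior_max_mean_curvature:
  assumes "p \<in> surface_interior M \<A>" "norm v = 1"
    and max: "\<And>q. q \<in> topspace M \<Longrightarrow> v \<bullet> X q \<le> v \<bullet> X p"
  shows "N p = v \<and> mean_curvature \<A> X N p \<le> 0 \<or> N p = - v \<and> mean_curvature \<A> X N p \<ge> 0"
proof -
  have "p \<in> topspace M" using assms(1) by (simp add: surface_interior_def)
  then obtain c where c: "c \<in> \<A>" "p \<in> fst c"
    by (rule ex_chart)
  let ?x = "snd c p" and ?f = "in_chart c X"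
  let ?h = "\<lambda>y. v \<bullet> ?f y"
  have int: "?x \<in> interior (snd c ` fst c)"
    using interior_mem[OF assms(1) c(1) chart_open[OF c(1)] c(2)] by simp
  have le: "?h y \<le> ?h ?x" if y: "y \<in> interior (snd c ` fst c)" for y
  proof -
    obtain q where q: "q \<in> fst c" "y = snd c q" using y interior_subset by blast
    then have "q \<in> topspace M" using chart_open[OF c(1)] openin_subset by blast
    then show ?thesis
      using max q c in_chart_apply[OF chart[OF c(1)], of _ X] by simp
  qed
  have loc: "\<forall>\<^sub>F y in nhds ?x. ?h y \<le> ?h ?x"
    using eventually_nhds_in_open[OF open_interior int] by eventually_elim (rule le)
  have td: "twice_diff ?h ?x" by (rule twice_diff_height[OF assms(1) c])
  have nonpos: "hess ?h ?x w w \<le> 0" for w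
    by (rule hess_nonpos_at_local_max[OF td loc])
  have hD: "(?h has_derivative (\<lambda>w. v \<bullet> diff_at c X p w)) (at ?x)"
    by (intro has_derivative_inner_right has_derivative_in_chart[OF smooth_X assms(1) c])
  have crit: "v \<bullet> diff_at c X p w = 0" for w
    using differential_zero_maxmin[OF int open_interior hD] le by metis
  obtain w\<^sub>1 w\<^sub>2 where w: "norm (diff_at c X p w\<^sub>1) = 1" "norm (diff_at c X p w\<^sub>2) = 1"
    "diff_at c X p w\<^sub>1 \<bullet> diff_at c X p w\<^sub>2 = 0"
    and H: "mean_curvature \<A> X N p = (hess (\<lambda>y. N p \<bullet> ?f y) ?x w\<^sub>1 w\<^sub>1
       + hess (\<lambda>y. N p \<bullet> ?f y) ?x w\<^sub>2 w\<^sub>2) / 2"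
    by (rule mean_curvature_eq_hess_trace[OF assms(1) c])
  have nN: "norm (N p) = 1" by (rule norm_N[OF c])
  have v: "v = (v \<bullet> N p) *\<^sub>R N p"
    using orthonormal_expansion3[OF nN w(1,2) N_orthogonal[OF c] N_orthogonal[OF c] w(3), of v] crit
    by simp
  then have "\<bar>v \<bullet> N p\<bar> = 1" using assms(2) nN by (metis mult.right_neutral norm_scaleR)
  then consider "N p = v" | "N p = - v"
    using v by (metis abs_eq_iff' abs_one minus_minus scaleR_minus1_left scaleR_one)
  then show ?thesis
  proof cases
    case 1
    then show ?thesis using H nonpos[of w\<^sub>1] nonpos[of w\<^sub>2] by simp
  next
    case 2
    have "hess (\<lambda>y. N p \<bullet> ?f y) ?x w w = - hess ?h ?x w w" for w
      using hess_uminus[OF td] twice_diff_height[OF assms(1) c, of "- v"] 2 by simp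
    then show ?thesis using 2 H nonpos[of w\<^sub>1] nonpos[of w\<^sub>2] by simp
  qed
qed

end

lemma H_surface_below:
  fixes v :: "real^3"
  assumes "norm v = 1" "\<H> v > 0" "\<H> (- v) < 0"
    and H: "H_surface \<H> M \<A> X N" and "compact_space M"
    and bd: "X ` surface_boundary \<A> \<subseteq> {x. x \<bullet> v = 0}"
    and p: "p \<in> surface_interior M \<A>"
  shows "X p \<bullet> v < 0"
proof (rule ccontr)
  assume neg: "\<not> X p \<bullet> v < 0"
  interpret immersed_surface M \<A> X N
    using H by unfold_locales (auto simp: H_surface_def oriented_immersed_surface_def)
  have no_max: False
    if q: "q \<in> surface_interior M \<A>" and max: "\<And>r. r \<in> topspace M \<Longrightarrow> v \<bullet> X r \<le> v \<bullet> X q" for q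
  proof -
    have "mean_curvature \<A> X N q = \<H> (N q)"
      using H q by (auto simp: H_surface_def surface_interior_def)
    then show False
      using interior_max_mean_curvature[OF q assms(1) max] assms(2,3) by auto
  qed
  have pM: "p \<in> topspace M" using p by (simp add: surface_interior_def)
  have "compactin euclidean (X ` topspace M)"
    using assms(5) by (intro image_compactin[OF _ continuous_map_smooth_function[OF smooth_X]])
      (simp add: compact_space_def)
  then have "compact (X ` topspace M)" by simp
  moreover have "continuous_on (X ` topspace M) (\<lambda>x. v \<bullet> x)" by (intro continuous_intros)
  ultimately obtain q where q: "q \<in> topspace M" "\<And>r. r \<in> topspace M \<Longrightarrow> v \<bullet> X r \<le> v \<bullet> X q"
    using continuous_attains_sup[of "X ` topspace M" "\<lambda>x. v \<bullet> x"] pM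
    by (metis (no_types, lifting) empty_iff image_iff)
  show False
  proof (cases "q \<in> surface_interior M \<A>")
    case True
    then show False using no_max q(2) by blast
  next
    case False
    then have "q \<in> surface_boundary \<A>" using q(1) by (simp add: surface_interior_def)
    then have "v \<bullet> X q = 0" using bd by (auto simp: inner_commute)
    then have "v \<bullet> X r \<le> v \<bullet> X p" if "r \<in> topspace M" for r
      using q(2)[OF that] neg by (simp add: inner_commute)
    then show False using no_max p by blast
  qed
qed

theorem theorem4p3:
  fixes \<H> :: "real^3 \<Rightarrow> real" and v :: "real^3"
    and M :: "'a topology" and \<A> :: "'a chart set" and X N :: "'a \<Rightarrow> real^3"
  assumes "C_diff 1 (sphere 0 1) \<H>"
    and "v \<in> sphere 0 1"
    and "\<H> v * \<H> (- v) < 0"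
    and "H_surface \<H> M \<A> X N"
    and "compact_space M"
    and "X ` surface_boundary \<A> \<subseteq> {x. x \<bullet> v = 0}"
  shows "(\<H> v > 0 \<longrightarrow> X ` surface_interior M \<A> \<subseteq> {x. x \<bullet> v < 0}) \<and>
         (\<H> v < 0 \<longrightarrow> X ` surface_interior M \<A> \<subseteq> {x. x \<bullet> v > 0})"
proof (intro conjI impI subsetI)
  fix x assume pos: "\<H> v > 0" and "x \<in> X ` surface_interior M \<A>"
  moreover have "\<H> (- v) < 0" using assms(3) pos by (simp add: mult_less_0_iff)
  ultimately show "x \<in> {x. x \<bullet> v < 0}"
    using H_surface_below[of v \<H> M \<A> X N] assms by auto
next
  fix x assume neg: "\<H> v < 0" and "x \<in> X ` surface_interior M \<A>"
  moreover have "\<H> (- v) > 0" using assms(3) neg by (simp add: mult_less_0_iff)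
  ultimately show "x \<in> {x. x \<bullet> v > 0}"
    using H_surface_below[of "- v" \<H> M \<A> X N] assms by auto
qed

end
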